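(* Let $\ell\ge 0$ be an integer and let $\mathbf{x}=(x_1,x_2,\ldots)$, $\mathbf{y}=(y_1,y_2,\ldots)$, $\mathbf{r}=(r_1,r_2,\ldots)$ be complex valued sequences with $\mathbf{r}$ injective, i.e. $r_i\neq r_j$ for $i\neq j$. Then for every integer $k\ge \ell+2$ the complex $k\times k$ matrix $A(k;\mathbf{x},\mathbf{y},\mathbf{r},\ell)=(A_{ij})_{1\le i,j\le k}$ with entries $$A_{ij}=(x_i+r_jy_i)^\ell$$ is singular.
   Context: A square matrix is singular if it is not invertible. The convention $z^0=1$ for all complex $z$ is used. *)

theory Defs
  imports Complex_Main "Jordan_Normal_Form.Matrix"
begin

definition singular_mat :: "'a :: semiring_1 mat \<Rightarrow> bool" where
  "singular_mat A \<longleftrightarrow> square_mat A \<and> \<not> invertible_mat A"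

(* Sequences are indexed from 1, so their value at 0 is never used; matrix
   indices start at 0, hence the shift. In Isabelle/HOL, z ^ 0 = 1 also for z = 0. *)
definition A_mat ::
  "nat \<Rightarrow> (nat \<Rightarrow> complex) \<Rightarrow> (nat \<Rightarrow> complex) \<Rightarrow> (nat \<Rightarrow> complex) \<Rightarrow> nat \<Rightarrow> complex mat" where
  "A_mat k x y r l = mat k k (\<lambda>(i, j). (x (Suc i) + r (Suc j) * y (Suc i)) ^ l)"

end

(* The binomial theorem factors the matrix as B * C with C the Vandermonde-type matrix of powers
   of r and B containing the binomial coefficients; the columns of B beyond l vanish, since then
   l choose m = 0, and k > l + 1 ensures there is such a column. *)
theory Submission
  imports Defs "Jordan_Normal_Form.Determinant"
begin

text \<open>If \<open>D\<close> inverts \<open>B * C\<close>, then \<open>C * D\<close> is a right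
  inverse of the square matrix \<open>B\<close>, hence also a left inverse over a field. But any
  \<open>E * B\<close> inherits the zero column \<open>j\<close> of \<open>B\<close>, so its
  diagonal entry there cannot be 1.\<close>

lemma singular_mult_zero_col:
  fixes B C :: "'a :: field mat"
  assumes B: "B \<in> carrier_mat n n" and C: "C \<in> carrier_mat n n"
    and j: "j < n" and zero: "\<And>i. i < n \<Longrightarrow> B $$ (i, j) = 0"
  shows "singular_mat (B * C)"
proof -
  have False if inv_BC: "invertible_mat (B * C)"
  proof -
    obtain D where "inverts_mat (B * C) D" "inverts_mat D (B * C)"
      using inv_BC by (auto simp: invertible_mat_def)
    then have eq: "B * C * D = 1\<^sub>m n" and "D * (B * C) = 1\<^sub>m (dim_row D)"
      using B by (auto simp: inverts_mat_def)
    \<comment> \<open>\<open>inverts_mat\<close> does not fix the shape of \<open>D\<close>;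
      comparing column counts in both identities does.\<close>
    then have "dim_col (B * C * D) = n" "dim_col (D * (B * C)) = dim_row D"
      by (simp_all only: index_one_mat)
    then have "dim_col D = n" "dim_col C = dim_row D"
      by simp_all
    then have D: "D \<in> carrier_mat n n"
      using carrier_matD[OF C] by (metis carrier_matI)
    obtain E where E: "E \<in> carrier_mat n n" and "B * E = 1\<^sub>m n"
      using that[OF mult_carrier_mat[OF C D]] eq assoc_mult_mat[OF B C D] by simp
    then have inv: "E * B = 1\<^sub>m n"
      using mat_mult_left_right_inverse[OF B E] by blast
    have "(E * B) $$ (j, j) = (\<Sum>i<n. E $$ (j, i) * B $$ (i, j))"
      using B E j by (simp add: scalar_prod_def atLeast0LessThan)
    also have "\<dots> = 0"
      using zero by simp
    finally show False
      using inv j by simp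
  qed
  then show ?thesis
    using B C by (auto simp: singular_mat_def)
qed

lemma A_mat_factorization:
  assumes "l < k"
  shows "A_mat k x y r l =
    mat k k (\<lambda>(i, m). of_nat (l choose m) * y (Suc i) ^ m * x (Suc i) ^ (l - m)) *
    mat k k (\<lambda>(m, j). r (Suc j) ^ m)" (is "_ = ?B * ?C")
proof (rule eq_matI)
  fix i j assume "i < dim_row (?B * ?C)" "j < dim_col (?B * ?C)"
  then have ij: "i < k" "j < k"
    by simp_all
  have "A_mat k x y r l $$ (i, j) = (r (Suc j) * y (Suc i) + x (Suc i)) ^ l"
    using ij by (simp add: A_mat_def add.commute)
  also have "\<dots> = (\<Sum>m\<le>l. of_nat (l choose m) * y (Suc i) ^ m * x (Suc i) ^ (l - m) * r (Suc j) ^ m)"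
    unfolding binomial_ring by (rule sum.cong) (simp_all add: power_mult_distrib)
  \<comment> \<open>The added terms have m > l, so their binomial coefficient is 0; the truncated
    exponent \<open>l - m\<close> is harmless there.\<close>
  also have "\<dots> = (\<Sum>m<k. of_nat (l choose m) * y (Suc i) ^ m * x (Suc i) ^ (l - m) * r (Suc j) ^ m)"
    using assms by (intro sum.mono_neutral_left) auto
  also have "\<dots> = (?B * ?C) $$ (i, j)"
    using ij by (simp add: scalar_prod_def atLeast0LessThan)
  finally show "A_mat k x y r l $$ (i, j) = (?B * ?C) $$ (i, j)" .
qed (simp_all add: A_mat_def)

theorem theorem1:
  fixes l :: nat and x y r :: "nat \<Rightarrow> complex"
  assumes "inj_on r {1..}"
  shows "\<forall>k \<ge> l + 2. singular_mat (A_mat k x y r l)"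
proof (intro allI impI)
  fix k assume k: "k \<ge> l + 2"
  \<comment> \<open>Column \<open>Suc l\<close> of the left factor carries
    \<open>l choose Suc l\<close> = 0; k \<ge> l + 2 makes this index valid.\<close>
  then show "singular_mat (A_mat k x y r l)"
    by (subst A_mat_factorization) (auto intro!: singular_mult_zero_col[where j = "Suc l" and n = k])
qed

end
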